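(* Let $\mathcal{K}\ge 1$ and $l_1,\dots,l_{\mathcal{K}}\ge 1$ be integers, and let $R=\mathcal{K}+\sum_{i=1}^{\mathcal{K}} l_i$. Assume that the number of measurements is $S=R$, and let $\mathcal{P}_S:\mathbb{C}^R\to\mathbb{C}^S$ be the Prony map. Let $\boldsymbol{x}=(\{a_{i,j}\},\{\xi_i\})\in\mathbb{C}^R$ be a regular point of $\mathcal{P}_S$ and assume $\varepsilon>0$ to be small enough so that the inverse function $\mathcal{N}=\mathcal{P}_S^{-1}$ (the local inverse with $\mathcal{N}(\boldsymbol{y})=\boldsymbol{x}$) exists in the $\varepsilon$-neighborhood of $\boldsymbol{y}=\mathcal{P}_S(\boldsymbol{x})$. Then there exists a positive constant $C_1$ depending only on $\xi_1,\dots,\xi_{\mathcal{K}}$ and $l_1,\dots,l_{\mathcal{K}}$ such that for all $i=1,\dots,\mathcal{K}$: $$\mathcal{ACC}_{LOC}(\boldsymbol{x},\varepsilon,a_{i,j})=\begin{cases} C_1\varepsilon, & j=0,\\[2pt] C_1\varepsilon\left(1+\dfrac{|a_{i,j-1}|}{|a_{i,l_i-1}|}\right), & 1\le j\le l_i-1,\end{cases}$$ $$\mathcal{ACC}_{LOC}(\boldsymbol{x},\varepsilon,\xi_i)= C_1\varepsilon\,\frac{1}{|a_{i,l_i-1}|}.$$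
   Context: Parameters: a point of $\mathbb{C}^R$ is written $\boldsymbol{x}=(\{a_{i,j}\},\{\xi_i\})$ with $a_{i,j}\in\mathbb{C}$ for $1\le i\le\mathcal{K}$, $0\le j\le l_i-1$, and $\xi_i\in\mathbb{C}$ for $1\le i\le\mathcal{K}$; its coordinates are ordered as $a_{1,0},\dots,a_{1,l_1-1},\xi_1,\dots,a_{\mathcal{K},0},\dots,a_{\mathcal{K},l_{\mathcal{K}}-1},\xi_{\mathcal{K}}$. Prony map: $\mathcal{P}_S:\mathbb{C}^R\to\mathbb{C}^S$ is defined by $\mathcal{P}_S(\{a_{i,j}\},\{\xi_i\})=(m_0,m_1,\dots,m_{S-1})$, where $$m_k=\sum_{i=1}^{\mathcal{K}}\sum_{j=0}^{l_i-1}a_{i,j}\,(k)_j\,\xi_i^{k-j},$$ $(k)_j=k(k-1)\cdots(k-j+1)$ is the falling factorial (with $(k)_0=1$), and the expression $(k)_j\xi_i^{k-j}$ is defined to be $0$ when $k<j$. When $S=R$, a point $\boldsymbol{x}$ is a critical point of $\mathcal{P}_S$ if the determinant of the (complex) Jacobian matrix of $\mathcal{P}_S$ vanishes at $\boldsymbol{x}$; otherwise it is a regular point. Balls: $B(\boldsymbol{y},\varepsilon)$ is the $\varepsilon$-ball around $\boldsymbol{y}\in\mathbb{C}^S$ in the distance $\operatorname{dist}(\boldsymbol{u},\boldsymbol{v})=\max_i|u_i-v_i|$; "$\varepsilon$-neighborhood" refers to this ball. Local point-wise accuracy: for a regular point $\boldsymbol{x}$, with $\boldsymbol{y}=\mathcal{P}_S(\boldsymbol{x})$,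 with $\varepsilon$ small enough that the local inverse $\mathcal{N}$ of $\mathcal{P}_S$ with $\mathcal{N}(\boldsymbol{y})=\boldsymbol{x}$ exists in the $\varepsilon$-neighborhood of $\boldsymbol{y}$, and for a parameter $p$ (one of the $a_{i,j}$ or $\xi_i$, identified with its coordinate index in $\{1,\dots,R\}$), $$\mathcal{ACC}_{LOC}(\boldsymbol{x},\varepsilon,p)=\sup_{\tilde{\boldsymbol{y}}\in B(\boldsymbol{y},\varepsilon)}\left|\left[\mathcal{J}_{\mathcal{N}}(\boldsymbol{y})(\tilde{\boldsymbol{y}}-\boldsymbol{y})\right]_p\right|,$$ where $\mathcal{J}_{\mathcal{N}}(\boldsymbol{y})$ is the Jacobian matrix of $\mathcal{N}$ at $\boldsymbol{y}$ and $[\boldsymbol{v}]_p$ is the $p$-th component of $\boldsymbol{v}$.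
   Formalization: The equalities with one C_1 fail (K=1, l_1=1, ξ_1≠0), so C_1 is replaced by factors in [c,C] with c>0, C depending only on the ξ_i and l_i: fixed for each a_{i,0} and ξ_i given these; for a_{i,j}, j≥1, the factor may also vary with the a's. *)

theory Defs
  imports "HOL-Analysis.Analysis"
begin

text \<open>
  Nodes are numbered \<open>0, \<dots>, K - 1\<close>, so that \<open>a i j\<close> and \<open>\<xi> i\<close> below are \<open>a\<^sub>i\<^sub>+\<^sub>1\<^sub>,\<^sub>j\<close> and
  \<open>\<xi>\<^sub>i\<^sub>+\<^sub>1\<close> in one-based notation. The parameters are ordered as
  \<open>a 0 0, \<dots>, a 0 (l 0 - 1), \<xi> 0, a 1 0, \<dots>, a 1 (l 1 - 1), \<xi> 1, \<dots>\<close>; the next three functions give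
  positions in this list. A point of complex R-space is a vector of type \<open>complex ^ 'r\<close> with
  \<open>CARD('r) = R\<close>; since \<open>'r\<close> carries no order, an enumeration \<open>e\<close> of the index type (a bijection
  from \<open>{..<R}\<close>) tells which component of the vector is the parameter at a given position.
\<close>

definition block_start :: "(nat \<Rightarrow> nat) \<Rightarrow> nat \<Rightarrow> nat" where
  "block_start l i = (\<Sum>i'<i. (l i' + 1))"

definition coeff_pos :: "(nat \<Rightarrow> nat) \<Rightarrow> nat \<Rightarrow> nat \<Rightarrow> nat" where
  "coeff_pos l i j = block_start l i + j"

definition node_pos :: "(nat \<Rightarrow> nat) \<Rightarrow> nat \<Rightarrow> nat" where
  "node_pos l i = block_start l i + l i"

definition falling_factorial :: "nat \<Rightarrow> nat \<Rightarrow> nat" where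
  "falling_factorial k j = (\<Prod>t<j. k - t)"

definition prony_moment ::
    "nat \<Rightarrow> (nat \<Rightarrow> nat) \<Rightarrow> (nat \<Rightarrow> 'r::finite) \<Rightarrow> complex ^ 'r \<Rightarrow> nat \<Rightarrow> complex" where
  "prony_moment K l e x k =
     (\<Sum>i<K. \<Sum>j<l i. x $ e (coeff_pos l i j) *
        (if k < j then 0
         else of_nat (falling_factorial k j) * (x $ e (node_pos l i)) ^ (k - j)))"

text \<open>
  The number of measurements is \<open>CARD('s)\<close>; \<open>d\<close> enumerates the components of the measurement vector.
\<close>

definition prony_map ::
    "nat \<Rightarrow> (nat \<Rightarrow> nat) \<Rightarrow> (nat \<Rightarrow> 'r::finite) \<Rightarrow> (nat \<Rightarrow> 's::finite)
      \<Rightarrow> complex ^ 'r \<Rightarrow> complex ^ 's" where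
  "prony_map K l e d x =
     (\<chi> s. prony_moment K l e x (the_inv_into {..<CARD('s)} d s))"

text \<open>
  \<^const>\<open>jacobian\<close> is the matrix of the Frechet derivative applied to the unit vectors
  \<open>axis q 1\<close>. For a map between complex vector spaces that is complex differentiable, as all maps
  below are, this is the complex Jacobian matrix (of complex partial derivatives).
\<close>

definition critical_point :: "(complex ^ 'n \<Rightarrow> complex ^ 'n::finite) \<Rightarrow> complex ^ 'n \<Rightarrow> bool" where
  "critical_point f x \<longleftrightarrow> det (jacobian f (at x)) = 0"

abbreviation regular_point :: "(complex ^ 'n \<Rightarrow> complex ^ 'n::finite) \<Rightarrow> complex ^ 'n \<Rightarrow> bool" where
  "regular_point f x \<equiv> \<not> critical_point f x"

definition max_dist :: "complex ^ 's::finite \<Rightarrow> complex ^ 's \<Rightarrow> real" where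
  "max_dist u v = Max (range (\<lambda>s. cmod (u $ s - v $ s)))"

definition max_ball :: "complex ^ 's::finite \<Rightarrow> real \<Rightarrow> (complex ^ 's) set" where
  "max_ball y \<epsilon> = {y'. max_dist y y' < \<epsilon>}"

text \<open>
  \<open>N\<close> is the inverse of \<open>f\<close> near \<open>x\<close>, in the sense of the inverse function theorem, defined on the
  \<open>\<epsilon>\<close>-neighborhood of \<open>f x\<close>. Differentiability of \<open>N\<close> is not required: at a regular point it follows.
\<close>

definition local_inverse ::
    "(complex ^ 'n \<Rightarrow> complex ^ 'n::finite) \<Rightarrow> complex ^ 'n \<Rightarrow> real
      \<Rightarrow> (complex ^ 'n \<Rightarrow> complex ^ 'n) \<Rightarrow> bool" where
  "local_inverse f x \<epsilon> N \<longleftrightarrow>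
     (\<exists>U. open U \<and> x \<in> U \<and> homeomorphism U (max_ball (f x) \<epsilon>) f N)"

text \<open>
  Local point-wise accuracy of the parameter with index \<open>p\<close> at \<open>x\<close>, for the local inverse \<open>N\<close> of \<open>f\<close>.
\<close>

definition acc_loc ::
    "(complex ^ 'n \<Rightarrow> complex ^ 'n::finite) \<Rightarrow> (complex ^ 'n \<Rightarrow> complex ^ 'n)
      \<Rightarrow> complex ^ 'n \<Rightarrow> real \<Rightarrow> 'n \<Rightarrow> real" where
  "acc_loc f N x \<epsilon> p =
     (SUP y' \<in> max_ball (f x) \<epsilon>. cmod ((jacobian N (at (f x)) *v (y' - f x)) $ p))"

end

theory Submission
  imports Defs
begin

text \<open>
  Write \<open>u\<^sub>i\<^sub>,\<^sub>j\<close> for the column with entries \<open>(k)\<^sub>j \<xi>\<^sub>i ^ (k - j)\<close>, where \<open>0 \<le> j \<le> l\<^sub>i\<close>. The partial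
  derivative of the Prony map in \<open>a\<^sub>i\<^sub>,\<^sub>j\<close> is \<open>u\<^sub>i\<^sub>,\<^sub>j\<close> and the one in \<open>\<xi>\<^sub>i\<close> is the sum of the
  \<open>a\<^sub>i\<^sub>,\<^sub>j u\<^sub>i\<^sub>,\<^sub>j\<^sub>+\<^sub>1\<close> over \<open>j < l\<^sub>i\<close>. Hence the Jacobian factors as \<open>V D\<close>: the columns of \<open>V\<close> are all the
  \<open>u\<^sub>i\<^sub>,\<^sub>j\<close> (a confluent Vandermonde matrix, which depends only on the nodes and the \<open>l\<^sub>i\<close>), and \<open>D\<close>
  is block diagonal and contains the coefficients (\<open>confluent_coord\<close> is the action of \<open>D\<close>;
  \<open>has_derivative_prony_map\<close> is the factorization). Regularity means that \<open>V\<close> is invertible and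
  that no leading coefficient \<open>a\<^sub>i\<^sub>,\<^sub>l\<^sub>i\<^sub>-\<^sub>1\<close> vanishes.

  Let \<open>w\<^sub>i\<^sub>,\<^sub>j\<close> be the rows of the inverse of \<open>V\<close>. If \<open>v\<close> is the image of a perturbation \<open>h\<close> of the
  measurements under the Jacobian of the local inverse, then \<open>D v\<close> has the coordinates
  \<open>w\<^sub>i\<^sub>,\<^sub>j \<cdot> h\<close>, and solving each block of \<open>D\<close> gives the components of \<open>v\<close>:

    \<^item> \<open>w\<^sub>i\<^sub>,\<^sub>0 \<cdot> h\<close> for the coefficient \<open>a\<^sub>i\<^sub>,\<^sub>0\<close>,
    \<^item> \<open>(w\<^sub>i\<^sub>,\<^sub>l\<^sub>i \<cdot> h) / a\<^sub>i\<^sub>,\<^sub>l\<^sub>i\<^sub>-\<^sub>1\<close> for the node \<open>\<xi>\<^sub>i\<close>,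
    \<^item> \<open>(w\<^sub>i\<^sub>,\<^sub>j - t w\<^sub>i\<^sub>,\<^sub>l\<^sub>i) \<cdot> h\<close> with \<open>t = a\<^sub>i\<^sub>,\<^sub>j\<^sub>-\<^sub>1 / a\<^sub>i\<^sub>,\<^sub>l\<^sub>i\<^sub>-\<^sub>1\<close> for the coefficient \<open>a\<^sub>i\<^sub>,\<^sub>j\<close>, \<open>j \<ge> 1\<close>.

  The supremum of the modulus of a linear form over the ball of radius \<open>\<epsilon>\<close> in the maximum distance
  is \<open>\<epsilon>\<close> times the \<open>\<ell>\<^sup>1\<close> norm of its coefficients (\<open>SUP_linear_form_max_ball\<close>). This gives
  the accuracies exactly (\<open>acc_loc_prony\<close>).

  For the coefficients \<open>a\<^sub>i\<^sub>,\<^sub>j\<close> with \<open>j \<ge> 1\<close> it remains to see that the \<open>\<ell>\<^sup>1\<close> norm of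
  \<open>w\<^sub>i\<^sub>,\<^sub>j - t w\<^sub>i\<^sub>,\<^sub>l\<^sub>i\<close> is comparable with \<open>1 + |t|\<close>, uniformly in \<open>t\<close> (\<open>dual_rows_bounds\<close>).
  The triangle inequality bounds it from above. From below, pairing this row with the columns
  \<open>u\<^sub>i\<^sub>,\<^sub>j\<close> and \<open>u\<^sub>i\<^sub>,\<^sub>l\<^sub>i\<close> yields \<open>1\<close> and \<open>-t\<close>, so both \<open>1\<close> and \<open>|t|\<close> are at most the norm times the
  largest entry of \<open>V\<close>.

  If \<open>V\<close> is singular, there is no regular point with the given nodes, and any positive constants will do.
\<close>

section \<open>Parameter positions\<close>

text \<open>
  A slot \<open>(i, j)\<close> stands for the coefficient \<open>a i j\<close> if \<open>j < l i\<close> and for the node \<open>\<xi> i\<close> if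
  \<open>j = l i\<close>. The same pairs label the columns of the confluent Vandermonde matrix, where
  \<open>j\<close> is the order of the derivative.
\<close>

definition slots :: "nat \<Rightarrow> (nat \<Rightarrow> nat) \<Rightarrow> (nat \<times> nat) set" where
  "slots K l = (SIGMA i:{..<K}. {..l i})"

definition slot_pos :: "(nat \<Rightarrow> nat) \<Rightarrow> nat \<times> nat \<Rightarrow> nat" where
  "slot_pos l = (\<lambda>(i, j). block_start l i + j)"

lemma finite_slots [simp]: "finite (slots K l)"
  by (simp add: slots_def)

lemma sum_slots: "(\<Sum>p\<in>slots K l. F p) = (\<Sum>i<K. \<Sum>j\<le>l i. F (i, j))"
  by (simp add: slots_def sum.Sigma)

lemma block_start_add_le:
  assumes "i < i'"
  shows "block_start l i + l i < block_start l i'"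
proof -
  have "block_start l i + (l i + 1) = (\<Sum>t<Suc i. (l t + 1))"
    by (simp add: block_start_def)
  also have "\<dots> \<le> block_start l i'"
    unfolding block_start_def using assms by (intro sum_mono2) auto
  finally show ?thesis by simp
qed

lemma bij_betw_slot_pos: "bij_betw (slot_pos l) (slots K l) {..<block_start l K}"
proof -
  have inj: "inj_on (slot_pos l) (slots K l)"
  proof (rule inj_onI)
    fix p q
    assume p: "p \<in> slots K l" and q: "q \<in> slots K l" and eq: "slot_pos l p = slot_pos l q"
    obtain i j i' j' where pq: "p = (i, j)" "q = (i', j')" by (cases p, cases q) auto
    have "\<not> i < i'" "\<not> i' < i"
      using block_start_add_le[of i i' l] block_start_add_le[of i' i l] p q eq
      by (auto simp: pq slots_def slot_pos_def)
    with eq show "p = q" by (simp add: pq slot_pos_def)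
  qed
  have sub: "slot_pos l ` slots K l \<subseteq> {..<block_start l K}"
  proof
    fix s assume "s \<in> slot_pos l ` slots K l"
    then obtain i j where ij: "i < K" "j \<le> l i" "s = block_start l i + j"
      by (auto simp: slots_def slot_pos_def)
    with block_start_add_le[of i K l] show "s \<in> {..<block_start l K}" by simp
  qed
  \<comment> \<open>Surjectivity by counting: both sides have \<open>block_start l K\<close> elements.\<close>
  have "card (slots K l) = block_start l K"
    by (simp add: slots_def block_start_def)
  then have "card (slot_pos l ` slots K l) = card {..<block_start l K}"
    by (simp add: card_image[OF inj])
  with sub have "slot_pos l ` slots K l = {..<block_start l K}"
    by (intro card_subset_eq) auto
  with inj show ?thesis by (simp add: bij_betw_def)
qed

section \<open>The factored Jacobian\<close>

text \<open>
  The confluent Vandermonde matrix: the \<open>j\<close>-th derivative of the power function of exponent \<open>k\<close>,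
  at the node \<open>\<xi> i\<close>.
\<close>

definition confluent_entry :: "(nat \<Rightarrow> complex) \<Rightarrow> nat \<Rightarrow> nat \<Rightarrow> nat \<Rightarrow> complex" where
  "confluent_entry \<xi> i j k = (if k < j then 0 else of_nat (falling_factorial k j) * \<xi> i ^ (k - j))"

text \<open>
  The block diagonal factor of the Jacobian at \<open>x\<close>, applied to the tangent vector \<open>v\<close>: a change of
  \<open>a i j\<close> contributes to slot \<open>(i, j)\<close>, and a change of \<open>\<xi> i\<close> raises the order of each derivative
  by one, so that \<open>a i (j - 1)\<close> contributes to slot \<open>(i, j)\<close>.
\<close>

definition confluent_coord ::
    "(nat \<Rightarrow> nat) \<Rightarrow> (nat \<Rightarrow> 'n::finite) \<Rightarrow> complex ^ 'n \<Rightarrow> complex ^ 'n \<Rightarrow> nat \<times> nat \<Rightarrow> complex" where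
  "confluent_coord l e x v = (\<lambda>(i, j).
     (if j < l i then v $ e (coeff_pos l i j) else 0) +
     (if j = 0 then 0 else x $ e (coeff_pos l i (j - 1)) * v $ e (node_pos l i)))"

text \<open>
  Differentiating \<open>(k)\<^sub>j \<xi> ^ (k - j)\<close> in \<open>\<xi>\<close> gives the entry of order \<open>j + 1\<close> because
  \<open>(k)\<^sub>j\<^sub>+\<^sub>1 = (k)\<^sub>j (k - j)\<close>; at \<open>k = j\<close> both the derivative and that entry are \<open>0\<close>.
\<close>

lemma confluent_entry_deriv:
  fixes x :: "complex ^ 'n::finite"
  assumes "x $ q = \<xi> i"
  shows "((\<lambda>x. x $ p * (if k < j then 0 else of_nat (falling_factorial k j) * (x $ q) ^ (k - j)))
     has_derivative
       (\<lambda>v. v $ p * confluent_entry \<xi> i j k + x $ p * v $ q * confluent_entry \<xi> i (Suc j) k)) (at x)"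
proof (cases "k < j")
  case True
  then show ?thesis by (simp add: confluent_entry_def)
next
  case False
  have nth: "((\<lambda>x. x $ r) has_derivative (\<lambda>v. v $ r)) (at x)" for r
    by (rule bounded_linear.has_derivative[OF bounded_linear_vec_nth has_derivative_ident])
  have ff: "falling_factorial k (Suc j) = falling_factorial k j * (k - j)"
    by (simp add: falling_factorial_def)
  show ?thesis
  proof (cases "k = j")
    case True
    then show ?thesis
      by (auto simp: confluent_entry_def intro!: derivative_eq_intros nth)
  next
    case neq: False
    with False have "k > j" by simp
    have "((\<lambda>x. x $ p * (of_nat (falling_factorial k j) * (x $ q) ^ (k - j)))
      has_derivative (\<lambda>v. x $ p * (of_nat (falling_factorial k j) *
        (of_nat (k - j) * v $ q * (x $ q) ^ (k - j - 1))) +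
        v $ p * (of_nat (falling_factorial k j) * (x $ q) ^ (k - j)))) (at x)"
      by (intro has_derivative_mult has_derivative_mult_right has_derivative_power nth)
    then show ?thesis
      using \<open>k > j\<close> by (simp add: confluent_entry_def ff assms algebra_simps)
  qed
qed

text \<open>
  Each coefficient column \<open>u\<^sub>i\<^sub>,\<^sub>j\<close> and the shifted columns from the derivative in \<open>\<xi> i\<close> are
  collected by slot; this is the factorization \<open>V D\<close> of the derivative.
\<close>

lemma has_derivative_prony_map:
  fixes x :: "complex ^ 'n::finite"
  assumes "\<forall>i<K. x $ e (node_pos l i) = \<xi> i"
  shows "(prony_map K l e (d :: nat \<Rightarrow> 's::finite) has_derivative
     (\<lambda>v. \<chi> s. \<Sum>p\<in>slots K l. confluent_entry \<xi> (fst p) (snd p) (the_inv_into {..<CARD('s)} d s) *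
        confluent_coord l e x v p)) (at x)"
proof (subst has_derivative_componentwise_within, intro ballI)
  fix b :: "complex ^ 's" assume "b \<in> Basis"
  have *: "((\<lambda>x. prony_moment K l e x k) has_derivative
     (\<lambda>v. \<Sum>p\<in>slots K l. confluent_entry \<xi> (fst p) (snd p) k * confluent_coord l e x v p)) (at x)"
    for k
  proof -
    have "((\<lambda>x. prony_moment K l e x k) has_derivative
      (\<lambda>v. \<Sum>i<K. \<Sum>j<l i. v $ e (coeff_pos l i j) * confluent_entry \<xi> i j k +
         x $ e (coeff_pos l i j) * v $ e (node_pos l i) * confluent_entry \<xi> i (Suc j) k)) (at x)"
      unfolding prony_moment_def using assms
      by (intro has_derivative_sum confluent_entry_deriv) auto
    moreover have "(\<Sum>j<l i. v $ e (coeff_pos l i j) * confluent_entry \<xi> i j k +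
         x $ e (coeff_pos l i j) * v $ e (node_pos l i) * confluent_entry \<xi> i (Suc j) k) =
       (\<Sum>j\<le>l i. confluent_entry \<xi> i j k * confluent_coord l e x v (i, j))" for v i
    proof -
      have "(\<Sum>j\<le>l i. confluent_entry \<xi> i j k * confluent_coord l e x v (i, j)) =
        (\<Sum>j\<le>l i. if j < l i then v $ e (coeff_pos l i j) * confluent_entry \<xi> i j k else 0) +
        (\<Sum>j\<le>l i. if j = 0 then 0 else
           x $ e (coeff_pos l i (j - 1)) * v $ e (node_pos l i) * confluent_entry \<xi> i j k)"
        unfolding sum.distrib[symmetric]
        by (intro sum.cong) (auto simp: confluent_coord_def algebra_simps)
      also have "(\<Sum>j\<le>l i. if j < l i then v $ e (coeff_pos l i j) * confluent_entry \<xi> i j k else 0) =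
        (\<Sum>j<l i. v $ e (coeff_pos l i j) * confluent_entry \<xi> i j k)"
        by (simp flip: lessThan_Suc_atMost)
      also have "(\<Sum>j\<le>l i. if j = 0 then 0 else
           x $ e (coeff_pos l i (j - 1)) * v $ e (node_pos l i) * confluent_entry \<xi> i j k) =
        (\<Sum>j<l i. x $ e (coeff_pos l i j) * v $ e (node_pos l i) * confluent_entry \<xi> i (Suc j) k)"
        by (simp add: sum.lessThan_Suc_shift flip: lessThan_Suc_atMost del: sum.lessThan_Suc)
      finally show ?thesis by (simp add: sum.distrib)
    qed
    ultimately show ?thesis by (simp add: sum_slots)
  qed
  show "((\<lambda>x. prony_map K l e d x \<bullet> b) has_derivative
     (\<lambda>v. (\<chi> s. \<Sum>p\<in>slots K l. confluent_entry \<xi> (fst p) (snd p) (the_inv_into {..<CARD('s)} d s) *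
        confluent_coord l e x v p) \<bullet> b)) (at x)"
    unfolding inner_vec_def prony_map_def vec_lambda_beta
    by (intro has_derivative_sum has_derivative_inner_left *)
qed

section \<open>Linear forms on balls in the maximum distance\<close>

lemma max_ball_iff:
  "y' \<in> max_ball y \<epsilon> \<longleftrightarrow> (\<forall>s. cmod ((y' - y) $ s) < \<epsilon>)"
  by (auto simp: max_ball_def max_dist_def norm_minus_commute)

lemma open_max_ball: "open (max_ball y \<epsilon>)"
proof -
  have "max_ball y \<epsilon> = (\<Inter>s. {y'. cmod (y' $ s - y $ s) < \<epsilon>})"
    by (auto simp: max_ball_iff)
  then show ?thesis
    by (auto intro!: open_INT open_Collect_less continuous_intros)
qed

text \<open>
  The \<open>\<ell>\<^sup>1\<close> norm is dual to the maximum norm. The ball is open, so the supremum is not attained;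
  it is approached along the perturbations whose components have modulus \<open>z * \<epsilon>\<close> with \<open>z < 1\<close> and
  the phases that make all terms of the form nonnegative.
\<close>

lemma SUP_linear_form_max_ball:
  fixes w y :: "complex ^ 'n::finite"
  assumes "\<epsilon> > 0"
  shows "(SUP y' \<in> max_ball y \<epsilon>. cmod (\<Sum>s\<in>UNIV. w $ s * (y' - y) $ s)) = (\<Sum>s\<in>UNIV. cmod (w $ s)) * \<epsilon>"
proof (rule cSup_eq_non_empty)
  have "y \<in> max_ball y \<epsilon>" using assms by (simp add: max_ball_iff)
  then show "(\<lambda>y'. cmod (\<Sum>s\<in>UNIV. w $ s * (y' - y) $ s)) ` max_ball y \<epsilon> \<noteq> {}" by blast
next
  fix r assume "r \<in> (\<lambda>y'. cmod (\<Sum>s\<in>UNIV. w $ s * (y' - y) $ s)) ` max_ball y \<epsilon>"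
  then obtain y' where y': "y' \<in> max_ball y \<epsilon>" and r: "r = cmod (\<Sum>s\<in>UNIV. w $ s * (y' - y) $ s)"
    by blast
  have "r \<le> (\<Sum>s\<in>UNIV. cmod (w $ s) * \<epsilon>)"
    unfolding r
    using y' unfolding max_ball_iff
    by (intro sum_norm_le) (simp add: norm_mult mult_left_mono less_imp_le)
  then show "r \<le> (\<Sum>s\<in>UNIV. cmod (w $ s)) * \<epsilon>" by (simp add: sum_distrib_right)
next
  fix b
  assume b: "\<And>r. r \<in> (\<lambda>y'. cmod (\<Sum>s\<in>UNIV. w $ s * (y' - y) $ s)) ` max_ball y \<epsilon> \<Longrightarrow> r \<le> b"
  show "(\<Sum>s\<in>UNIV. cmod (w $ s)) * \<epsilon> \<le> b"
  proof (rule field_le_mult_one_interval)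
    fix z :: real assume z: "0 < z" "z < 1"
    define y' where "y' = y + (\<chi> s. of_real (z * \<epsilon>) * cnj (sgn (w $ s)))"
    have "cmod ((y' - y) $ s) < \<epsilon>" for s
      using z assms by (auto simp: y'_def norm_mult norm_sgn)
    then have "y' \<in> max_ball y \<epsilon>" by (simp add: max_ball_iff)
    then have "cmod (\<Sum>s\<in>UNIV. w $ s * (y' - y) $ s) \<le> b" using b by blast
    moreover have "w $ s * (y' - y) $ s = of_real (z * \<epsilon> * cmod (w $ s))" for s
    proof -
      have "u * cnj (sgn u) = of_real (cmod u)" for u :: complex
        by (cases "u = 0")
          (simp_all add: sgn_eq complex_norm_square[symmetric] power2_eq_square divide_simps)
      then show ?thesis by (simp add: y'_def algebra_simps)
    qed
    then have "(\<Sum>s\<in>UNIV. w $ s * (y' - y) $ s) = of_real (z * \<epsilon> * (\<Sum>s\<in>UNIV. cmod (w $ s)))"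
      by (simp only: sum_distrib_left of_real_sum)
    then have "cmod (\<Sum>s\<in>UNIV. w $ s * (y' - y) $ s) = \<bar>z * \<epsilon> * (\<Sum>s\<in>UNIV. cmod (w $ s))\<bar>"
      by (simp only: norm_of_real)
    ultimately show "z * ((\<Sum>s\<in>UNIV. cmod (w $ s)) * \<epsilon>) \<le> b"
      by (simp add: mult_ac)
  qed
qed

section \<open>The Jacobian of a local inverse\<close>

lemma the_inv_into_bij_betw:
  assumes "bij_betw g A B" "a \<in> A"
  shows "the_inv_into A g (g a) = a"
  using assms by (auto simp: bij_betw_def the_inv_into_f_f)

lemma sum_the_inv_into_enum:
  assumes "bij_betw e {..<n} (UNIV :: 'n::finite set)"
  shows "(\<Sum>s\<in>UNIV. F s (the_inv_into {..<n} e s)) = (\<Sum>k<n. F (e k) k)"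
proof -
  have "(\<Sum>k<n. F (e k) (the_inv_into {..<n} e (e k))) = (\<Sum>s\<in>UNIV. F s (the_inv_into {..<n} e s))"
    by (rule sum.reindex_bij_betw[OF assms])
  then show ?thesis using the_inv_into_bij_betw[OF assms] by simp
qed

text \<open>
  A continuous inverse of a map with invertible derivative is differentiable, so continuity of \<open>N\<close>
  on the ball suffices to identify its Jacobian as the inverse matrix.
\<close>

lemma jacobian_local_inverse:
  fixes f N :: "complex ^ 'n::finite \<Rightarrow> complex ^ 'n"
  assumes f: "(f has_derivative (\<lambda>v. A *v v)) (at x)"
    and reg: "regular_point f x" and eps: "\<epsilon> > 0" and N: "local_inverse f x \<epsilon> N"
  shows "A *v (jacobian N (at (f x)) *v h) = h"
proof -
  have "jacobian f (at x) = A"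
    by (simp add: jacobian_def frechet_derivative_at[OF f, symmetric])
  with reg have "invertible A" by (simp add: critical_point_def invertible_det_nz)
  then obtain B where B: "A ** B = mat 1" "B ** A = mat 1"
    by (auto simp: invertible_def)
  obtain U where U: "x \<in> U" "homeomorphism U (max_ball (f x) \<epsilon>) f N"
    using N by (auto simp: local_inverse_def)
  have y: "f x \<in> max_ball (f x) \<epsilon>" using eps by (simp add: max_ball_iff)
  have Nx: "N (f x) = x" using U by (auto simp: homeomorphism_def)
  have "(N has_derivative (\<lambda>v. B *v v)) (at (f x))"
  proof (rule has_derivative_inverse_basic)
    show "(f has_derivative (\<lambda>v. A *v v)) (at (N (f x)))" using f Nx by simp
    show "bounded_linear ((*v) B)"
      by (auto intro!: linear_linear[THEN iffD1] linearI
          simp: matrix_vector_right_distrib vec_eq_iff matrix_vector_mult_def scaleR_sum_right)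
    show "(\<lambda>v. B *v v) \<circ> (\<lambda>v. A *v v) = id"
      by (auto simp: matrix_vector_mul_assoc B)
    show "continuous (at (f x)) N"
      using U y open_max_ball by (metis continuous_on_eq_continuous_at homeomorphism_cont2)
    show "open (max_ball (f x) \<epsilon>)" by (rule open_max_ball)
    show "f x \<in> max_ball (f x) \<epsilon>" by (rule y)
    show "f (N z) = z" if "z \<in> max_ball (f x) \<epsilon>" for z
      using U(2) that by (auto simp: homeomorphism_def)
  qed
  then have "jacobian N (at (f x)) = B"
    by (simp add: jacobian_def frechet_derivative_at[symmetric])
  then show ?thesis by (simp add: matrix_vector_mul_assoc B)
qed

text \<open>
  Rows are addressed through the enumeration \<open>e\<close>, so that the right-hand side mentions only natural
  indices: the confluent factor is the same for all enumerations.
\<close>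

lemma prony_jacobian_matrix:
  fixes x :: "complex ^ 'n::finite"
  assumes e: "bij_betw e {..<CARD('n)} (UNIV :: 'n set)"
    and nodes: "\<forall>i<K. x $ e (node_pos l i) = \<xi> i"
  obtains A :: "complex ^ 'n ^ 'n"
  where "(prony_map K l e e has_derivative (\<lambda>v. A *v v)) (at x)"
    and "\<And>v k. k < CARD('n) \<Longrightarrow>
      (A *v v) $ e k = (\<Sum>p\<in>slots K l. confluent_entry \<xi> (fst p) (snd p) k * confluent_coord l e x v p)"
proof -
  define J where "J = (\<lambda>v. \<chi> s. \<Sum>p\<in>slots K l.
    confluent_entry \<xi> (fst p) (snd p) (the_inv_into {..<CARD('n)} e s) * confluent_coord l e x v p)"
  have add: "confluent_coord l e x (u + v) p = confluent_coord l e x u p + confluent_coord l e x v p"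
    and scale: "confluent_coord l e x (c *s u) p = c * confluent_coord l e x u p" for u v c p
    by (cases p; simp add: confluent_coord_def algebra_simps)+
  have "Vector_Spaces.linear (*s) (*s) J"
    unfolding Vector_Spaces.linear_iff
    by (intro conjI allI vec.vector_space_axioms)
      (simp_all add: J_def vec_eq_iff add scale sum.distrib sum_distrib_left algebra_simps)
  then have J: "matrix J *v v = J v" for v by (rule matrix_works)
  have "(prony_map K l e e has_derivative (\<lambda>v. matrix J *v v)) (at x)"
    using has_derivative_prony_map[of K x e l \<xi> e, OF nodes] unfolding J unfolding J_def .
  moreover have "(matrix J *v v) $ e k =
      (\<Sum>p\<in>slots K l. confluent_entry \<xi> (fst p) (snd p) k * confluent_coord l e x v p)"
    if "k < CARD('n)" for v k
    using that the_inv_into_bij_betw[OF e] unfolding J unfolding J_def by simp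
  ultimately show thesis by (rule that)
qed

section \<open>Rows of the inverse confluent Vandermonde matrix\<close>

text \<open>
  \<open>W\<close> is a left inverse of the confluent Vandermonde matrix. Its rows are labelled by slots and its
  columns by natural numbers, hence one \<open>W\<close> serves all enumerations of the index type; this is why
  the constants of the theorem depend only on \<open>\<xi>\<close> and \<open>l\<close>.
\<close>

definition dual_rows ::
    "nat \<Rightarrow> (nat \<Rightarrow> nat) \<Rightarrow> (nat \<Rightarrow> complex) \<Rightarrow> (nat \<times> nat \<Rightarrow> nat \<Rightarrow> complex) \<Rightarrow> bool" where
  "dual_rows K l \<xi> W \<longleftrightarrow> (\<forall>p\<in>slots K l. \<forall>q\<in>slots K l.
     (\<Sum>k<block_start l K. W p k * confluent_entry \<xi> (fst q) (snd q) k) = (if p = q then 1 else 0))"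

text \<open>
  At a regular point the Jacobian \<open>V D\<close> is surjective, hence so is its left factor \<open>V\<close>, and a
  surjective square matrix has a left inverse.
\<close>

lemma dual_rows_exist:
  fixes x :: "complex ^ 'n::finite"
  assumes card: "CARD('n) = block_start l K"
    and e: "bij_betw e {..<CARD('n)} (UNIV :: 'n set)"
    and nodes: "\<forall>i<K. x $ e (node_pos l i) = \<xi> i"
    and reg: "regular_point (prony_map K l e e) x"
  shows "\<exists>W. dual_rows K l \<xi> W"
proof -
  let ?n = "CARD('n)"
  obtain A where A: "(prony_map K l e e has_derivative (\<lambda>v. A *v v)) (at x)"
    and Ae: "\<And>v k. k < ?n \<Longrightarrow> (A *v v) $ e k =
      (\<Sum>p\<in>slots K l. confluent_entry \<xi> (fst p) (snd p) k * confluent_coord l e x v p)"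
    using prony_jacobian_matrix[OF e nodes] by blast
  have "jacobian (prony_map K l e e) (at x) = A"
    by (simp add: jacobian_def frechet_derivative_at[OF A, symmetric])
  with reg have "invertible A" by (simp add: critical_point_def invertible_det_nz)
  then obtain A' where A': "A ** A' = mat 1" by (auto simp: invertible_def)
  define E where "E = e \<circ> slot_pos l"
  have E: "bij_betw E (slots K l) UNIV"
    unfolding E_def using bij_betw_trans[OF bij_betw_slot_pos e[unfolded card]] .
  define dec where "dec = the_inv_into (slots K l) E"
  define enc where "enc = the_inv_into {..<?n} e"
  have dec: "dec (E p) = p" if "p \<in> slots K l" for p
    unfolding dec_def using the_inv_into_bij_betw[OF E that] .
  have enc: "enc (e k) = k" if "k < ?n" for k
    unfolding enc_def using the_inv_into_bij_betw[OF e] that by simp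
  define V :: "complex ^ 'n ^ 'n" where
    "V = (\<chi> s q. confluent_entry \<xi> (fst (dec q)) (snd (dec q)) (enc s))"
  have "V *v (\<chi> q. confluent_coord l e x v (dec q)) = A *v v" for v
  proof -
    have "(V *v (\<chi> q. confluent_coord l e x v (dec q))) $ e k = (A *v v) $ e k" if k: "k < ?n" for k
    proof -
      have "(V *v (\<chi> q. confluent_coord l e x v (dec q))) $ e k =
        (\<Sum>q\<in>UNIV. confluent_entry \<xi> (fst (dec q)) (snd (dec q)) k * confluent_coord l e x v (dec q))"
        using k by (simp add: V_def matrix_vector_mult_def enc)
      also have "\<dots> = (\<Sum>p\<in>slots K l. confluent_entry \<xi> (fst (dec (E p))) (snd (dec (E p))) k *
          confluent_coord l e x v (dec (E p)))"
        by (rule sum.reindex_bij_betw[OF E, symmetric])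
      also have "\<dots> = (A *v v) $ e k" using k by (simp add: Ae dec)
      finally show ?thesis .
    qed
    moreover have "\<exists>k<?n. s = e k" for s
      using e by (auto simp: bij_betw_def)
    ultimately show ?thesis by (metis vec_eq_iff)
  qed
  then have "surj ((*v) V)"
    by (metis A' matrix_vector_mul_assoc matrix_vector_mul_lid surj_def)
  then obtain B where B: "B ** V = mat 1"
    by (metis matrix_left_right_inverse matrix_right_invertible_surjective)
  have "(\<Sum>k<block_start l K. B $ E p $ e k * confluent_entry \<xi> (fst q) (snd q) k) = (if p = q then 1 else 0)"
    if p: "p \<in> slots K l" and q: "q \<in> slots K l" for p q
  proof -
    have "(\<Sum>k<?n. B $ E p $ e k * V $ e k $ E q) = (B ** V) $ E p $ E q"
      using sum.reindex_bij_betw[OF e, of "\<lambda>s. B $ E p $ s * V $ s $ E q"]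
      by (simp add: matrix_matrix_mult_def)
    also have "\<dots> = (if p = q then 1 else 0)"
      using E p q by (auto simp: B mat_def bij_betw_def inj_on_eq_iff)
    finally show ?thesis using q card by (simp add: V_def enc dec)
  qed
  then show ?thesis unfolding dual_rows_def by (intro exI[of _ "\<lambda>p k. B $ E p $ e k"]) blast
qed

lemma confluent_coord_dual_rows:
  assumes W: "dual_rows K l \<xi> W" and p: "p \<in> slots K l"
    and h: "\<And>k. k < block_start l K \<Longrightarrow>
      h k = (\<Sum>q\<in>slots K l. confluent_entry \<xi> (fst q) (snd q) k * z q)"
  shows "(\<Sum>k<block_start l K. W p k * h k) = z p"
proof -
  have "(\<Sum>k<block_start l K. W p k * h k) =
    (\<Sum>k<block_start l K. \<Sum>q\<in>slots K l. W p k * confluent_entry \<xi> (fst q) (snd q) k * z q)"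
    using h by (simp add: sum_distrib_left mult.assoc)
  also have "\<dots> = (\<Sum>q\<in>slots K l. (\<Sum>k<block_start l K. W p k * confluent_entry \<xi> (fst q) (snd q) k) * z q)"
    by (subst sum.swap) (simp add: sum_distrib_right)
  also have "\<dots> = (\<Sum>q\<in>slots K l. if p = q then z q else 0)"
    using W p by (intro sum.cong) (auto simp: dual_rows_def)
  also have "\<dots> = z p" using p by simp
  finally show ?thesis .
qed

text \<open>
  Applying the left inverse of \<open>V\<close> to \<open>V D v = h\<close> leaves \<open>D v\<close>. The perturbation \<open>v\<close> of the parameters
  is thus known up to solving the small triangular blocks of \<open>D\<close>.
\<close>

lemma jacobian_local_inverse_prony:
  fixes x :: "complex ^ 'n::finite" and N :: "complex ^ 'n \<Rightarrow> complex ^ 'n"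
  assumes card: "CARD('n) = block_start l K"
    and e: "bij_betw e {..<CARD('n)} (UNIV :: 'n set)"
    and nodes: "\<forall>i<K. x $ e (node_pos l i) = \<xi> i"
    and reg: "regular_point (prony_map K l e e) x"
    and eps: "\<epsilon> > 0"
    and N: "local_inverse (prony_map K l e e) x \<epsilon> N"
    and W: "dual_rows K l \<xi> W"
    and p: "p \<in> slots K l"
  shows "confluent_coord l e x (jacobian N (at (prony_map K l e e x)) *v h) p =
    (\<Sum>k<block_start l K. W p k * h $ e k)"
proof -
  obtain A where A: "(prony_map K l e e has_derivative (\<lambda>v. A *v v)) (at x)"
    and Ae: "\<And>v k. k < CARD('n) \<Longrightarrow> (A *v v) $ e k =
      (\<Sum>p\<in>slots K l. confluent_entry \<xi> (fst p) (snd p) k * confluent_coord l e x v p)"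
    using prony_jacobian_matrix[OF e nodes] by blast
  define v where "v = jacobian N (at (prony_map K l e e x)) *v h"
  have "A *v v = h"
    unfolding v_def using jacobian_local_inverse[OF A reg eps N] .
  then show ?thesis
    unfolding v_def[symmetric]
    by (intro confluent_coord_dual_rows[OF W p, symmetric]) (use Ae card in metis)
qed

section \<open>Exact accuracies\<close>

definition row_norm :: "nat \<Rightarrow> (nat \<Rightarrow> nat) \<Rightarrow> (nat \<Rightarrow> complex) \<Rightarrow> real" where
  "row_norm K l w = (\<Sum>k<block_start l K. cmod (w k))"

lemma acc_loc_eq_row_norm:
  fixes x :: "complex ^ 'n::finite"
  assumes card: "CARD('n) = block_start l K"
    and e: "bij_betw e {..<CARD('n)} (UNIV :: 'n set)"
    and eps: "\<epsilon> > 0"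
    and w: "\<And>h. (jacobian N (at (f x)) *v h) $ p = (\<Sum>k<block_start l K. w k * h $ e k)"
  shows "acc_loc f N x \<epsilon> p = row_norm K l w * \<epsilon>"
proof -
  define enc where "enc = the_inv_into {..<CARD('n)} e"
  have "acc_loc f N x \<epsilon> p =
    (SUP y' \<in> max_ball (f x) \<epsilon>. cmod (\<Sum>s\<in>UNIV. (\<chi> s. w (enc s)) $ s * (y' - f x) $ s))"
    unfolding acc_loc_def w enc_def
    using sum_the_inv_into_enum[OF e, of "\<lambda>s k. w k * (_ - f x) $ s"] card by simp
  also have "\<dots> = (\<Sum>s\<in>UNIV. cmod (w (enc s))) * \<epsilon>"
    by (subst SUP_linear_form_max_ball[OF eps]) simp
  also have "(\<Sum>s\<in>UNIV. cmod (w (enc s))) = row_norm K l w"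
    unfolding enc_def row_norm_def
    using sum_the_inv_into_enum[OF e, of "\<lambda>s k. cmod (w k)"] card by simp
  finally show ?thesis .
qed

text \<open>
  Only the change of \<open>\<xi> i\<close>, multiplied by the leading coefficient, contributes to slot \<open>(i, l i)\<close>.
  If that coefficient vanished, the column of this slot would not be in the range of the Jacobian.
\<close>

lemma leading_coeff_nonzero:
  fixes x :: "complex ^ 'n::finite"
  assumes card: "CARD('n) = block_start l K"
    and e: "bij_betw e {..<CARD('n)} (UNIV :: 'n set)"
    and nodes: "\<forall>i<K. x $ e (node_pos l i) = \<xi> i"
    and reg: "regular_point (prony_map K l e e) x"
    and eps: "\<epsilon> > 0"
    and N: "local_inverse (prony_map K l e e) x \<epsilon> N"
    and W: "dual_rows K l \<xi> W"
    and i: "i < K" "l i \<ge> 1"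
  shows "x $ e (coeff_pos l i (l i - 1)) \<noteq> 0"
proof
  assume 0: "x $ e (coeff_pos l i (l i - 1)) = 0"
  let ?p = "(i, l i)"
  have p: "?p \<in> slots K l" using i by (simp add: slots_def)
  define h :: "complex ^ 'n" where
    "h = (\<chi> s. confluent_entry \<xi> i (l i) (the_inv_into {..<CARD('n)} e s))"
  have "(\<Sum>k<block_start l K. W ?p k * h $ e k) =
    (\<Sum>k<block_start l K. W ?p k * confluent_entry \<xi> i (l i) k)"
    using card the_inv_into_bij_betw[OF e] by (simp add: h_def)
  also have "\<dots> = 1" using W p unfolding dual_rows_def by fastforce
  finally show False
    using jacobian_local_inverse_prony[OF card e nodes reg eps N W p, of h] i 0
    by (simp add: confluent_coord_def)
qed

text \<open>
  Slots \<open>(i, 0)\<close> and \<open>(i, l i)\<close> give the changes of \<open>a i 0\<close> and, after division by the leading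
  coefficient, of \<open>\<xi> i\<close>. Slot \<open>(i, j)\<close> with \<open>1 \<le> j < l i\<close> mixes the changes of \<open>a i j\<close> and \<open>\<xi> i\<close>;
  substituting the latter expresses the former as a combination of two dual rows.
\<close>

lemma acc_loc_prony:
  fixes x :: "complex ^ 'n::finite"
  assumes card: "CARD('n) = block_start l K"
    and e: "bij_betw e {..<CARD('n)} (UNIV :: 'n set)"
    and nodes: "\<forall>i<K. x $ e (node_pos l i) = \<xi> i"
    and reg: "regular_point (prony_map K l e e) x"
    and eps: "\<epsilon> > 0"
    and N: "local_inverse (prony_map K l e e) x \<epsilon> N"
    and W: "dual_rows K l \<xi> W"
    and i: "i < K" "l i \<ge> 1"
  defines "a \<equiv> \<lambda>j. x $ e (coeff_pos l i j)"
  shows "acc_loc (prony_map K l e e) N x \<epsilon> (e (coeff_pos l i 0)) = row_norm K l (W (i, 0)) * \<epsilon>"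
    and "acc_loc (prony_map K l e e) N x \<epsilon> (e (node_pos l i)) =
      row_norm K l (W (i, l i)) * \<epsilon> * (1 / cmod (a (l i - 1)))"
    and "j \<in> {1..l i - 1} \<Longrightarrow> acc_loc (prony_map K l e e) N x \<epsilon> (e (coeff_pos l i j)) =
      row_norm K l (\<lambda>k. W (i, j) k - a (j - 1) / a (l i - 1) * W (i, l i) k) * \<epsilon>"
proof -
  let ?v = "\<lambda>h. jacobian N (at (prony_map K l e e x)) *v h"
  let ?R = "\<lambda>j h. \<Sum>k<block_start l K. W (i, j) k * h $ e k"
  note acc = acc_loc_eq_row_norm[OF card e eps]
  have a: "a (l i - 1) \<noteq> 0"
    unfolding a_def using leading_coeff_nonzero[OF card e nodes reg eps N W i] .
  have coord: "confluent_coord l e x (?v h) (i, j) = ?R j h" if "j \<le> l i" for h j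
    using that i by (intro jacobian_local_inverse_prony[OF card e nodes reg eps N W])
      (auto simp: slots_def)
  have first: "?v h $ e (coeff_pos l i 0) = ?R 0 h" for h
    using coord[of 0 h] i by (simp add: confluent_coord_def)
  then show "acc_loc (prony_map K l e e) N x \<epsilon> (e (coeff_pos l i 0)) = row_norm K l (W (i, 0)) * \<epsilon>"
    by (rule acc)
  have node: "?v h $ e (node_pos l i) = ?R (l i) h / a (l i - 1)" for h
    using coord[of "l i" h] i a by (simp add: confluent_coord_def a_def field_simps)
  then have "?v h $ e (node_pos l i) =
      (\<Sum>k<block_start l K. W (i, l i) k / a (l i - 1) * h $ e k)" for h
    by (simp add: sum_divide_distrib)
  from acc[of N "prony_map K l e e" x, OF this]
  show "acc_loc (prony_map K l e e) N x \<epsilon> (e (node_pos l i)) =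
      row_norm K l (W (i, l i)) * \<epsilon> * (1 / cmod (a (l i - 1)))"
    by (simp add: row_norm_def norm_divide sum_divide_distrib[symmetric])
  assume j: "j \<in> {1..l i - 1}"
  have "?v h $ e (coeff_pos l i j) = ?R j h - a (j - 1) / a (l i - 1) * ?R (l i) h" for h
  proof -
    have "j \<le> l i" "j < l i" "j \<noteq> 0" using j i by auto
    then have "?v h $ e (coeff_pos l i j) + a (j - 1) * ?v h $ e (node_pos l i) = ?R j h"
      using coord[of j h] by (simp add: confluent_coord_def a_def)
    then show ?thesis by (simp add: node algebra_simps)
  qed
  then have "?v h $ e (coeff_pos l i j) =
      (\<Sum>k<block_start l K. (W (i, j) k - a (j - 1) / a (l i - 1) * W (i, l i) k) * h $ e k)" for h
    by (simp add: sum_subtractf sum_distrib_left algebra_simps)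
  then show "acc_loc (prony_map K l e e) N x \<epsilon> (e (coeff_pos l i j)) =
      row_norm K l (\<lambda>k. W (i, j) k - a (j - 1) / a (l i - 1) * W (i, l i) k) * \<epsilon>"
    by (rule acc)
qed

section \<open>Two-sided bounds\<close>

lemma norm_pairing_le_row_norm:
  assumes "\<And>k. k < block_start l K \<Longrightarrow> cmod (c k) \<le> M"
  shows "cmod (\<Sum>k<block_start l K. w k * c k) \<le> row_norm K l w * M"
  unfolding row_norm_def sum_distrib_right using assms
  by (intro sum_norm_le) (simp add: norm_mult mult_left_mono)

text \<open>
  The bounds hold for all \<open>t\<close> at once, which makes them independent of the coefficients. Pairing
  the row \<open>W p - t W q\<close> with the columns \<open>p\<close> and \<open>q\<close> gives \<open>1\<close> and \<open>-t\<close>. If \<open>M\<close> bounds the entries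
  of all columns, then \<open>1 + |t|\<close> is at most \<open>2 * M\<close> times the norm of the row; this explains the
  choice of \<open>c\<close>.
\<close>

lemma dual_rows_bounds:
  assumes W: "dual_rows K l \<xi> W"
  obtains c C :: real where "0 < c" "c \<le> C"
    and "\<And>p. p \<in> slots K l \<Longrightarrow> row_norm K l (W p) \<in> {c..C}"
    and "\<And>p q t. p \<in> slots K l \<Longrightarrow> q \<in> slots K l \<Longrightarrow> p \<noteq> q \<Longrightarrow>
      row_norm K l (\<lambda>k. W p k - t * W q k) / (1 + cmod t) \<in> {c..C}"
proof -
  let ?n = "block_start l K"
  let ?V = "\<lambda>p. confluent_entry \<xi> (fst p) (snd p)"
  \<comment> \<open>The summand \<open>1\<close> keeps \<open>M\<close> positive.\<close>
  define M where "M = 1 + (\<Sum>p\<in>slots K l. \<Sum>k<?n. cmod (?V p k))"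
  define c where "c = 1 / (2 * M)"
  define C where "C = c + (\<Sum>p\<in>slots K l. row_norm K l (W p))"
  have nonneg: "row_norm K l w \<ge> 0" for w by (simp add: row_norm_def sum_nonneg)
  have M: "M > 0" unfolding M_def by (intro add_pos_nonneg sum_nonneg) auto
  then have c: "c > 0" by (simp add: c_def)
  have VM: "cmod (?V p k) \<le> M" if "p \<in> slots K l" "k < ?n" for p k
  proof -
    have "cmod (?V p k) \<le> (\<Sum>k<?n. cmod (?V p k))"
      using that by (intro member_le_sum) auto
    also have "\<dots> \<le> (\<Sum>p\<in>slots K l. \<Sum>k<?n. cmod (?V p k))"
      using that by (intro member_le_sum sum_nonneg) auto
    finally show ?thesis by (simp add: M_def)
  qed
  have dual: "(\<Sum>k<?n. W p k * ?V q k) = (if p = q then 1 else 0)"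
    if "p \<in> slots K l" "q \<in> slots K l" for p q
    using W that by (simp add: dual_rows_def)
  have upper: "row_norm K l (W p) \<le> C" if "p \<in> slots K l" for p
  proof -
    have "row_norm K l (W p) \<le> (\<Sum>p\<in>slots K l. row_norm K l (W p))"
      using that nonneg by (intro member_le_sum) auto
    with c show ?thesis by (simp add: C_def)
  qed
  show thesis
  proof (rule that)
    show "0 < c" by (rule c)
    show "c \<le> C" unfolding C_def using nonneg by (simp add: sum_nonneg)
    show "row_norm K l (W p) \<in> {c..C}" if p: "p \<in> slots K l" for p
    proof -
      have "1 \<le> row_norm K l (W p) * M"
        using norm_pairing_le_row_norm[of l K "?V p" M "W p"] VM p by (simp add: dual)
      then have "c \<le> row_norm K l (W p)" using M nonneg[of "W p"] by (simp add: c_def field_simps)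
      with upper[OF p] show ?thesis by simp
    qed
    show "row_norm K l (\<lambda>k. W p k - t * W q k) / (1 + cmod t) \<in> {c..C}"
      if p: "p \<in> slots K l" and q: "q \<in> slots K l" and pq: "p \<noteq> q" for p q t
    proof -
      let ?w = "\<lambda>k. W p k - t * W q k"
      have pair: "(\<Sum>k<?n. ?w k * ?V r k) =
          (if p = r then 1 else 0) - t * (if q = r then 1 else 0)" if "r \<in> slots K l" for r
      proof -
        have "(\<Sum>k<?n. ?w k * ?V r k) = (\<Sum>k<?n. W p k * ?V r k) - t * (\<Sum>k<?n. W q k * ?V r k)"
          by (simp add: sum_subtractf sum_distrib_left algebra_simps)
        then show ?thesis using that p q by (simp add: dual)
      qed
      have "1 \<le> row_norm K l ?w * M"
        using norm_pairing_le_row_norm[of l K "?V p" M ?w] VM p pq by (simp add: pair)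
      moreover have "cmod t \<le> row_norm K l ?w * M"
        using norm_pairing_le_row_norm[of l K "?V q" M ?w] VM q pq by (simp add: pair)
      ultimately have "c \<le> row_norm K l ?w / (1 + cmod t)"
        using M norm_ge_zero[of t] by (simp add: c_def divide_simps add_pos_nonneg)
      moreover have "row_norm K l ?w \<le> row_norm K l (W p) + cmod t * row_norm K l (W q)"
        unfolding row_norm_def sum_distrib_left sum.distrib[symmetric]
        by (intro sum_mono) (metis norm_mult norm_triangle_ineq4)
      then have "row_norm K l ?w \<le> C + cmod t * C"
        using upper[OF p] mult_left_mono[OF upper[OF q] norm_ge_zero[of t]] by linarith
      then have "row_norm K l ?w / (1 + cmod t) \<le> C"
        by (simp add: divide_simps add_pos_nonneg algebra_simps)
      ultimately show ?thesis by simp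
    qed
  qed
qed

theorem theorem4p5:
  fixes K :: nat and l :: "nat \<Rightarrow> nat" and \<xi> :: "nat \<Rightarrow> complex"
  assumes "K \<ge> 1"
    and "\<And>i. i < K \<Longrightarrow> l i \<ge> 1"
    and "CARD('n::finite) = K + (\<Sum>i<K. l i)"
  shows "\<exists>(c::real) C A X. 0 < c \<and> (\<forall>i<K. A i \<in> {c..C} \<and> X i \<in> {c..C}) \<and>
    (\<forall>(e :: nat \<Rightarrow> 'n) (x :: complex ^ 'n) (\<epsilon>::real) N.
       bij_betw e {..<CARD('n)} UNIV \<longrightarrow>
       (\<forall>i<K. x $ e (node_pos l i) = \<xi> i) \<longrightarrow>
       regular_point (prony_map K l e e) x \<longrightarrow>
       \<epsilon> > 0 \<longrightarrow>
       local_inverse (prony_map K l e e) x \<epsilon> N \<longrightarrow>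
       (\<forall>i<K.
          acc_loc (prony_map K l e e) N x \<epsilon> (e (coeff_pos l i 0)) = A i * \<epsilon> \<and>
          (\<forall>j\<in>{1..l i - 1}. \<exists>C1\<in>{c..C}.
             acc_loc (prony_map K l e e) N x \<epsilon> (e (coeff_pos l i j)) =
               C1 * \<epsilon> * (1 + cmod (x $ e (coeff_pos l i (j - 1)))
                              / cmod (x $ e (coeff_pos l i (l i - 1))))) \<and>
          acc_loc (prony_map K l e e) N x \<epsilon> (e (node_pos l i)) =
            X i * \<epsilon> * (1 / cmod (x $ e (coeff_pos l i (l i - 1))))))"
proof (cases "\<exists>W. dual_rows K l \<xi> W")
  case False
  have "CARD('n) = block_start l K" unfolding block_start_def sum.distrib using assms(3) by simp
  then have no_regular: False
    if "bij_betw e {..<CARD('n)} UNIV" "\<forall>i<K. x $ e (node_pos l i) = \<xi> i"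
      "regular_point (prony_map K l e e) x"
    for e :: "nat \<Rightarrow> 'n" and x
    using dual_rows_exist[OF _ that] False by metis
  have "(1::real) \<in> {1..1}" by simp
  then show ?thesis
    by (intro exI[of _ "1::real"] exI[of _ "\<lambda>_. 1::real"] conjI[OF zero_less_one] conjI)
      (blast, (intro allI impI, erule (2) no_regular[THEN FalseE]))
next
  case True
  then obtain W where W: "dual_rows K l \<xi> W" by blast
  obtain c C :: real where c: "0 < c" "c \<le> C"
    and row: "\<And>p. p \<in> slots K l \<Longrightarrow> row_norm K l (W p) \<in> {c..C}"
    and comb: "\<And>p q t. p \<in> slots K l \<Longrightarrow> q \<in> slots K l \<Longrightarrow> p \<noteq> q \<Longrightarrow>
      row_norm K l (\<lambda>k. W p k - t * W q k) / (1 + cmod t) \<in> {c..C}"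
    by (rule dual_rows_bounds[OF W]) (rule that; assumption)
  have card: "CARD('n) = block_start l K" unfolding block_start_def sum.distrib using assms(3) by simp
  define A where "A = (\<lambda>i. row_norm K l (W (i, 0)))"
  define X where "X = (\<lambda>i. row_norm K l (W (i, l i)))"
  have bounds: "\<forall>i<K. A i \<in> {c..C} \<and> X i \<in> {c..C}"
    using row by (simp add: A_def X_def slots_def)
  have accuracies: "acc_loc (prony_map K l e e) N x \<epsilon> (e (coeff_pos l i 0)) = A i * \<epsilon> \<and>
      (\<forall>j\<in>{1..l i - 1}. \<exists>C1\<in>{c..C}.
         acc_loc (prony_map K l e e) N x \<epsilon> (e (coeff_pos l i j)) =
           C1 * \<epsilon> * (1 + cmod (x $ e (coeff_pos l i (j - 1)))
                          / cmod (x $ e (coeff_pos l i (l i - 1))))) \<and>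
      acc_loc (prony_map K l e e) N x \<epsilon> (e (node_pos l i)) =
        X i * \<epsilon> * (1 / cmod (x $ e (coeff_pos l i (l i - 1))))"
    if e: "bij_betw e {..<CARD('n)} UNIV"
      and nodes: "\<forall>i<K. x $ e (node_pos l i) = \<xi> i"
      and reg: "regular_point (prony_map K l e e) x" and eps: "\<epsilon> > 0"
      and N: "local_inverse (prony_map K l e e) x \<epsilon> N" and i: "i < K"
    for e :: "nat \<Rightarrow> 'n" and x \<epsilon> N i
  proof (intro conjI ballI)
    note acc = acc_loc_prony[OF card e nodes reg eps N W i assms(2)[OF i]]
    show "acc_loc (prony_map K l e e) N x \<epsilon> (e (coeff_pos l i 0)) = A i * \<epsilon>"
      using acc(1) by (simp add: A_def)
    show "acc_loc (prony_map K l e e) N x \<epsilon> (e (node_pos l i)) =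
        X i * \<epsilon> * (1 / cmod (x $ e (coeff_pos l i (l i - 1))))"
      using acc(2) by (simp add: X_def)
    fix j assume j: "j \<in> {1..l i - 1}"
    define t where "t = x $ e (coeff_pos l i (j - 1)) / x $ e (coeff_pos l i (l i - 1))"
    define C1 where "C1 = row_norm K l (\<lambda>k. W (i, j) k - t * W (i, l i) k) / (1 + cmod t)"
    have "C1 \<in> {c..C}"
      unfolding C1_def using i j by (intro comb) (auto simp: slots_def)
    moreover have "1 + cmod t \<noteq> 0" using norm_ge_zero[of t] by linarith
    then have "acc_loc (prony_map K l e e) N x \<epsilon> (e (coeff_pos l i j)) = C1 * \<epsilon> * (1 + cmod t)"
      using acc(3)[OF j, folded t_def] by (simp add: C1_def)
    ultimately show "\<exists>C1\<in>{c..C}. acc_loc (prony_map K l e e) N x \<epsilon> (e (coeff_pos l i j)) =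
           C1 * \<epsilon> * (1 + cmod (x $ e (coeff_pos l i (j - 1)))
                          / cmod (x $ e (coeff_pos l i (l i - 1))))"
      by (auto simp: t_def norm_divide)
  qed
  show ?thesis
    by (rule exI[of _ c], rule exI[of _ C], rule exI[of _ A], rule exI[of _ X],
        intro conjI[OF c(1)] conjI[OF bounds], intro allI impI, rule accuracies)
qed

end
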